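(* Let $R$ be a unital ring with involution $*$ and let $a\in R$. Then: (i) $a$ is core invertible if and only if there exists an $(a,a^* )$-inverse of $a$. In this case the $(a,a^* )$-inverse of $a$ coincides with the core inverse of $a$. (ii) $a$ is dual core invertible if and only if there exists an $(a^*,a)$-inverse of $a$. In this case the $(a^*,a)$-inverse of $a$ coincides with the dual core inverse of $a$.
   Context: For $a\in R$: $aR=\{ax:x\in R\}$, $Ra=\{xa:x\in R\}$, and $aRb=\{axb:x\in R\}$. A core inverse of $a$ is an $x\in R$ with $axa=a$, $xR=aR$, $Rx=Ra^*$; a dual core inverse of $a$ is an $x\in R$ with $axa=a$, $xR=a^*R$, $Rx=Ra$ (each is unique when it exists); $a$ is (dual) core invertible if it has a (dual) core inverse. For $a,b,c\in R$, an element $x\in R$ is a $(b,c)$-inverse of $a$ if $x\in (bRx)\cap(xRc)$ and $xab=b$, $cax=c$; such $x$ is unique when it exists. *)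

theory Defs
  imports Main
begin

text \<open>
  Unital rings are rendered by the sort \<open>{ring, monoid_mult}\<close> rather than \<open>ring_1\<close>, because the
  latter also demands \<open>0 \<noteq> 1\<close> and so would exclude the zero ring.
\<close>

definition ring_involution :: "('a::{ring,monoid_mult} \<Rightarrow> 'a) \<Rightarrow> bool" where
  "ring_involution star \<longleftrightarrow>
     (\<forall>a. star (star a) = a) \<and>
     (\<forall>a b. star (a + b) = star a + star b) \<and>
     (\<forall>a b. star (a * b) = star b * star a)"

definition right_mults :: "'a::{ring,monoid_mult} \<Rightarrow> 'a set" where
  "right_mults a = {a * x | x. True}"

definition left_mults :: "'a::{ring,monoid_mult} \<Rightarrow> 'a set" where
  "left_mults a = {x * a | x. True}"

definition two_sided_mults :: "'a::{ring,monoid_mult} \<Rightarrow> 'a \<Rightarrow> 'a set" where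
  "two_sided_mults a b = {a * x * b | x. True}"

definition is_core_inverse :: "('a::{ring,monoid_mult} \<Rightarrow> 'a) \<Rightarrow> 'a \<Rightarrow> 'a \<Rightarrow> bool" where
  "is_core_inverse star a x \<longleftrightarrow>
     a * x * a = a \<and> right_mults x = right_mults a \<and> left_mults x = left_mults (star a)"

definition is_dual_core_inverse :: "('a::{ring,monoid_mult} \<Rightarrow> 'a) \<Rightarrow> 'a \<Rightarrow> 'a \<Rightarrow> bool" where
  "is_dual_core_inverse star a x \<longleftrightarrow>
     a * x * a = a \<and> right_mults x = right_mults (star a) \<and> left_mults x = left_mults a"

definition core_invertible :: "('a::{ring,monoid_mult} \<Rightarrow> 'a) \<Rightarrow> 'a \<Rightarrow> bool" where
  "core_invertible star a \<longleftrightarrow> (\<exists>x. is_core_inverse star a x)"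

definition dual_core_invertible :: "('a::{ring,monoid_mult} \<Rightarrow> 'a) \<Rightarrow> 'a \<Rightarrow> bool" where
  "dual_core_invertible star a \<longleftrightarrow> (\<exists>x. is_dual_core_inverse star a x)"

text \<open>\<open>is_bc_inverse b c a x\<close>: \<open>x\<close> is a \<open>(b, c)\<close>-inverse of \<open>a\<close>.\<close>

definition is_bc_inverse :: "'a::{ring,monoid_mult} \<Rightarrow> 'a \<Rightarrow> 'a \<Rightarrow> 'a \<Rightarrow> bool" where
  "is_bc_inverse b c a x \<longleftrightarrow>
     x \<in> two_sided_mults b x \<inter> two_sided_mults x c \<and> x * a * b = b \<and> c * a * x = c"

end

theory Submission
  imports Defs
begin

text \<open>
  Being a core inverse of \<open>a\<close> and being an \<open>(a, a\<^sup>*)\<close>-inverse of \<open>a\<close> are the same condition on \<open>x\<close>: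
  either one forces \<open>a x\<close> to be self-adjoint, after which the remaining identities are direct
  computations. Applying the involution turns the dual core statement for \<open>a\<close> into the core statement
  for \<open>a\<^sup>*\<close>. The coincidence of the inverses is then the uniqueness of \<open>(b, c)\<close>-inverses.
\<close>

text \<open>The product \<open>y * a * x\<close> collapses to \<open>x\<close> because
  \<open>x\<close> starts with \<open>b\<close> and \<open>y * a * b = b\<close>, and to
  \<open>y\<close> because \<open>y\<close> ends with \<open>c\<close> and
  \<open>c * a * x = c\<close>.\<close>

lemma is_bc_inverse_unique:
  assumes "is_bc_inverse b c a x" and "is_bc_inverse b c a y"
  shows "x = y"
proof -
  obtain s where s: "x = b * s * x" and x: "c * a * x = c"
    using assms(1) by (auto simp: is_bc_inverse_def two_sided_mults_def)
  obtain r where r: "y = y * r * c" and y: "y * a * b = b"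
    using assms(2) by (auto simp: is_bc_inverse_def two_sided_mults_def)
  have "y * a * x = x"
    using s y by (metis mult.assoc)
  moreover have "y * a * x = y"
    using r x by (metis mult.assoc)
  ultimately show ?thesis by simp
qed

text \<open>The unit puts each generator into its own ideal, so equality of principal ideals becomes
  a pair of factorizations usable in computations.\<close>

lemma right_mults_eq_iff:
  fixes x a :: "'a::{ring,monoid_mult}"
  shows "right_mults x = right_mults a \<longleftrightarrow> (\<exists>u. x = a * u) \<and> (\<exists>v. a = x * v)"
proof
  assume "right_mults x = right_mults a"
  moreover have "x \<in> right_mults x" "a \<in> right_mults a"
    by (auto simp: right_mults_def intro: exI[of _ 1])
  ultimately show "(\<exists>u. x = a * u) \<and> (\<exists>v. a = x * v)"
    by (auto simp: right_mults_def)
next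
  have "right_mults (y * z) \<subseteq> right_mults y" for y z :: 'a
    by (auto simp: right_mults_def mult.assoc)
  moreover assume "(\<exists>u. x = a * u) \<and> (\<exists>v. a = x * v)"
  ultimately show "right_mults x = right_mults a"
    by (metis subset_antisym)
qed

lemma left_mults_eq_iff:
  fixes x a :: "'a::{ring,monoid_mult}"
  shows "left_mults x = left_mults a \<longleftrightarrow> (\<exists>u. x = u * a) \<and> (\<exists>v. a = v * x)"
proof
  assume "left_mults x = left_mults a"
  moreover have "x \<in> left_mults x" "a \<in> left_mults a"
    by (auto simp: left_mults_def intro: exI[of _ 1])
  ultimately show "(\<exists>u. x = u * a) \<and> (\<exists>v. a = v * x)"
    by (auto simp: left_mults_def)
next
  have "left_mults (y * z) \<subseteq> left_mults z" for y z :: 'a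
    by (auto simp: left_mults_def simp flip: mult.assoc)
  moreover assume "(\<exists>u. x = u * a) \<and> (\<exists>v. a = v * x)"
  ultimately show "left_mults x = left_mults a"
    by (metis subset_antisym)
qed

context
  fixes star :: "'a::{ring,monoid_mult} \<Rightarrow> 'a"
  assumes inv: "ring_involution star"
begin

lemma star_star: "star (star a) = a"
  and star_mult: "star (a * b) = star b * star a"
  using inv by (auto simp: ring_involution_def)

lemma is_core_inverse_iff_bc_inverse:
  "is_core_inverse star a x \<longleftrightarrow> is_bc_inverse a (star a) a x"
proof
  assume "is_core_inverse star a x"
  then obtain u v w where axa: "a * x * a = a" and u: "x = a * u" and v: "a = x * v"
    and w: "x = w * star a"
    unfolding is_core_inverse_def right_mults_eq_iff left_mults_eq_iff by blast
  \<comment> \<open>The factor \<open>star a\<close> at the end of \<open>x\<close> is absorbed into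
    the star; then \<open>a * x * a = a\<close> turns the right side back into
    \<open>w * star a\<close>.\<close>
  have "x * star (a * x) = w * star (a * x * a)"
    by (subst w) (simp add: star_mult mult.assoc)
  then have xs: "x * star (a * x) = x"
    by (simp only: axa flip: w)
  \<comment> \<open>An element of the form \<open>p * star p\<close> is self-adjoint, so
    \<open>p = p * star p\<close> gives \<open>star p = p\<close>.\<close>
  then have "a * x = (a * x) * star (a * x)"
    by (simp add: mult.assoc)
  then have sa: "star (a * x) = a * x"
    by (metis star_mult star_star)
  then have xax: "x * a * x = x"
    using xs by (simp only: mult.assoc)
  have "x * a * a = a"
    using v xax by (metis mult.assoc)
  moreover have "star a * a * x = star a"
    using sa axa by (metis star_mult mult.assoc)
  \<comment> \<open>Both memberships come from \<open>x = x * a * x\<close>: here the first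
    \<open>x\<close> is replaced by \<open>a * u\<close>, next the last one by
    \<open>w * star a\<close>.\<close>
  moreover have "x = a * (u * a) * x"
    using u xax by (metis mult.assoc)
  moreover have "x = x * (a * w) * star a"
    using w xax by (metis mult.assoc)
  ultimately show "is_bc_inverse a (star a) a x"
    unfolding is_bc_inverse_def two_sided_mults_def by blast
next
  assume "is_bc_inverse a (star a) a x"
  then obtain s r where s: "x = a * s * x" and r: "x = x * r * star a"
    and xaa: "x * a * a = a" and sax: "star a * a * x = star a"
    unfolding is_bc_inverse_def two_sided_mults_def by blast
  \<comment> \<open>This is the image of \<open>sax\<close> under \<open>star\<close>. Multiplied by
    \<open>x\<close> it yields \<open>star p * p = p\<close> for \<open>p = a * x\<close>, so
    \<open>p\<close> is self-adjoint.\<close>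
  have adj: "star (a * x) * a = a"
    using sax by (metis star_mult star_star mult.assoc)
  then have "star (a * x) * (a * x) = a * x"
    by (metis mult.assoc)
  then have "star (a * x) = a * x"
    by (metis star_mult star_star)
  then have "a * x * a = a"
    using adj by simp
  moreover have "right_mults x = right_mults a"
    unfolding right_mults_eq_iff using s xaa by (metis mult.assoc)
  moreover have "left_mults x = left_mults (star a)"
    unfolding left_mults_eq_iff using r sax by metis
  ultimately show "is_core_inverse star a x"
    by (simp add: is_core_inverse_def)
qed

lemma star_eq_iff: "star p = star q \<longleftrightarrow> p = q"
  by (metis star_star)

lemma star_image_mults:
  "star ` right_mults p = left_mults (star p)"
  "star ` left_mults p = right_mults (star p)"
  "star ` two_sided_mults p q = two_sided_mults (star q) (star p)"
proof -
  \<comment> \<open>As \<open>star\<close> is an involution, \<open>star y\<close> ranges over the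
    whole ring: \<open>g y\<close> is the image of \<open>f (star y)\<close>.\<close>
  have *: "star ` {f y |y. True} = {g y |y. True}" if "\<And>y. star (f y) = g (star y)" for f g
  proof
    show "star ` {f y |y. True} \<subseteq> {g y |y. True}"
      using that by blast
    have "g y \<in> star ` {f y |y. True}" for y
      using that[of "star y"] by (metis (mono_tags, lifting) imageI mem_Collect_eq star_star)
    then show "{g y |y. True} \<subseteq> star ` {f y |y. True}"
      by blast
  qed
  show "star ` right_mults p = left_mults (star p)"
    unfolding right_mults_def left_mults_def by (rule *) (rule star_mult)
  show "star ` left_mults p = right_mults (star p)"
    unfolding right_mults_def left_mults_def by (rule *) (rule star_mult)
  show "star ` two_sided_mults p q = two_sided_mults (star q) (star p)"
    unfolding two_sided_mults_def by (rule *) (simp add: star_mult mult.assoc)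
qed

lemma inj_star: "inj star"
  by (simp add: inj_def star_eq_iff)

text \<open>Reversing products exchanges the roles of \<open>b\<close> and \<open>c\<close>, hence
  also the two absorption identities.\<close>

lemma is_bc_inverse_star:
  "is_bc_inverse (star c) (star b) (star a) (star x) \<longleftrightarrow> is_bc_inverse b c a x"
proof -
  have "star x * star a * star c = star c \<longleftrightarrow> c * a * x = c"
    using star_eq_iff[of "c * a * x" c] by (simp add: star_mult mult.assoc)
  moreover have "star b * star a * star x = star b \<longleftrightarrow> x * a * b = b"
    using star_eq_iff[of "x * a * b" b] by (simp add: star_mult mult.assoc)
  ultimately show ?thesis
    by (auto simp: is_bc_inverse_def star_image_mults(3)[symmetric] inj_image_mem_iff[OF inj_star])
qed

lemma is_core_inverse_star:
  "is_core_inverse star (star a) (star x) \<longleftrightarrow> is_dual_core_inverse star a x"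
proof -
  have "star a * star x * star a = star a \<longleftrightarrow> a * x * a = a"
    using star_eq_iff[of "a * x * a" a] by (simp add: star_mult mult.assoc)
  moreover have "right_mults (star x) = right_mults (star a) \<longleftrightarrow> left_mults x = left_mults a"
    by (simp add: star_image_mults(2)[symmetric] inj_image_eq_iff[OF inj_star])
  moreover have "left_mults (star x) = left_mults a \<longleftrightarrow> right_mults x = right_mults (star a)"
    using inj_image_eq_iff[OF inj_star, of "right_mults x" "right_mults (star a)"]
    by (simp add: star_image_mults(1) star_star)
  ultimately show ?thesis
    by (auto simp: is_core_inverse_def is_dual_core_inverse_def star_star)
qed

text \<open>The core case is applied to \<open>star a\<close> and \<open>star x\<close>, and both
  sides are carried back along \<open>star\<close>.\<close>

lemma is_dual_core_inverse_iff_bc_inverse: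
  "is_dual_core_inverse star a x \<longleftrightarrow> is_bc_inverse (star a) a a x"
  using is_core_inverse_star[of a x] is_core_inverse_iff_bc_inverse[of "star a" "star x"]
    is_bc_inverse_star[of a "star a" a x]
  by (simp add: star_star)

end

theorem theorem4p4:
  fixes star :: "'a::{ring,monoid_mult} \<Rightarrow> 'a" and a :: 'a
  assumes "ring_involution star"
  shows "(core_invertible star a \<longleftrightarrow> (\<exists>x. is_bc_inverse a (star a) a x)) \<and>
         (core_invertible star a \<longrightarrow>
           (\<forall>x y. is_bc_inverse a (star a) a x \<and> is_core_inverse star a y \<longrightarrow> x = y)) \<and>
         (dual_core_invertible star a \<longleftrightarrow> (\<exists>x. is_bc_inverse (star a) a a x)) \<and>
         (dual_core_invertible star a \<longrightarrow>
           (\<forall>x y. is_bc_inverse (star a) a a x \<and> is_dual_core_inverse star a y \<longrightarrow> x = y))"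
  using is_bc_inverse_unique
  unfolding core_invertible_def dual_core_invertible_def
    is_core_inverse_iff_bc_inverse[OF assms] is_dual_core_inverse_iff_bc_inverse[OF assms]
  by blast

end
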